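(* Let $M$ be an $m\times n$ integer matrix and $N=(b_{i,j})$ an $l\times n$ matrix with non-negative integer entries and columns $\mathbf b_1,\dots,\mathbf b_n$ (all columns nonzero), such that $I_N\subseteq I_M$. Let $\phi:K[x_1,\dots,x_n]\to K[t_1,\dots,t_l]$ be the $K$-algebra homomorphism $\phi(x_i)=\mathbf t^{\mathbf b_i}$ (so $I_N=\ker\phi$). Assume $\Gamma(N)=V(I_N)$ in $\bar K^n$. Let $f_1,\dots,f_s\in I_M$ and $J=(f_1,\dots,f_s)$. Then $I_M=\mathrm{rad}(I_N+J)$ if and only if $\mathrm{rad}((\phi(I_M))^e)=\mathrm{rad}(\phi(f_1),\dots,\phi(f_s))$.
   Context: $K$ is a field with algebraic closure $\bar K$. For an integer matrix $M$ with columns $\mathbf a_i\in\mathbb Z^m$ (each nonzero), the toric ideal $I_M\subseteq K[x_1,\dots,x_n]$ is the kernel of $x_i\mapsto \mathbf t^{\mathbf a_i}\in K[t_1^{\pm1},\dots,t_m^{\pm1}]$. $V(I_N)\subseteq\bar K^n$ is the common zero set of $I_N$, and the toric set $\Gamma(N)=\{(\mathbf T^{\mathbf b_1},\dots,\mathbf T^{\mathbf b_n}):\mathbf T=(T_1,\dots,T_l)\in\bar K^l\}$ where $\mathbf T^{\mathbf b_i}=T_1^{b_{1,i}}\cdots T_l^{b_{l,i}}$. $(\phi(I_M))^e$ denotes the ideal $\phi(I_M)K[t_1,\dots,t_l]$. *)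

theory Defs
  imports "HOL-Library.Poly_Mapping" "HOL-Algebra.Algebraic_Closure_Type"
begin

(* Multivariate polynomials: a polynomial with coefficients in 'k in the variables
  indexed by nat is a finitely supported map from exponent vectors (nat \<Rightarrow>_0 nat)
  to coefficients.  K[x_1,...,x_n] is the subring of polynomials involving only the
  variables with index < n (variable x_(i+1) has index i). *)

type_synonym 'k mpoly = "(nat \<Rightarrow>\<^sub>0 nat) \<Rightarrow>\<^sub>0 'k"

definition polys_in :: "nat \<Rightarrow> 'k::zero mpoly set" where
  "polys_in n = {f. \<forall>\<alpha>\<in>Poly_Mapping.keys f. \<forall>i\<in>Poly_Mapping.keys \<alpha>. i < n}"

definition gen_ideal :: "'a::comm_ring_1 set \<Rightarrow> 'a set \<Rightarrow> 'a set" where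
  "gen_ideal R S = {p. \<exists>F g. finite F \<and> F \<subseteq> S \<and> (\<forall>s\<in>F. g s \<in> R) \<and> p = (\<Sum>s\<in>F. g s * s)}"

definition radical :: "'a::comm_ring_1 set \<Rightarrow> 'a set \<Rightarrow> 'a set" where
  "radical R I = {p \<in> R. \<exists>k. p ^ k \<in> I}"

definition ideal_sum :: "'a::plus set \<Rightarrow> 'a set \<Rightarrow> 'a set" where
  "ideal_sum I J = {a + b | a b. a \<in> I \<and> b \<in> J}"

(* The exponent vector M\<alpha> = \<Sum>_i \<alpha>_i a_i, where a_i = col i is the i-th column. *)
definition col_exp :: "(nat \<Rightarrow> (nat \<Rightarrow>\<^sub>0 'e::semiring_1)) \<Rightarrow> (nat \<Rightarrow>\<^sub>0 nat) \<Rightarrow> (nat \<Rightarrow>\<^sub>0 'e)" where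
  "col_exp col \<alpha> = (\<Sum>i\<in>Poly_Mapping.keys \<alpha>. Poly_Mapping.map (\<lambda>z. of_nat (Poly_Mapping.lookup \<alpha> i) * z) (col i))"

(* The K-algebra homomorphism x_i |-> t^(col i), into the (Laurent) monoid algebra
  K[t^(exponents 'e)]: for 'e = int this is K[t_1^\<pm>1,...], for 'e = nat it is K[t_1,...]. *)
definition toric_map :: "(nat \<Rightarrow> (nat \<Rightarrow>\<^sub>0 'e::semiring_1)) \<Rightarrow> 'k::comm_ring_1 mpoly \<Rightarrow> ((nat \<Rightarrow>\<^sub>0 'e) \<Rightarrow>\<^sub>0 'k)" where
  "toric_map col f = (\<Sum>\<alpha>\<in>Poly_Mapping.keys f. Poly_Mapping.single (col_exp col \<alpha>) (Poly_Mapping.lookup f \<alpha>))"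

definition toric_ideal :: "nat \<Rightarrow> (nat \<Rightarrow> (nat \<Rightarrow>\<^sub>0 int)) \<Rightarrow> 'k::comm_ring_1 mpoly set" where
  "toric_ideal n col = {f \<in> polys_in n. toric_map col f = 0}"

definition eval_ac :: "'k::field mpoly \<Rightarrow> (nat \<Rightarrow> 'k alg_closure) \<Rightarrow> 'k alg_closure" where
  "eval_ac f x = (\<Sum>\<alpha>\<in>Poly_Mapping.keys f. to_ac (Poly_Mapping.lookup f \<alpha>) * (\<Prod>i\<in>Poly_Mapping.keys \<alpha>. x i ^ Poly_Mapping.lookup \<alpha> i))"

definition points :: "nat \<Rightarrow> (nat \<Rightarrow> 'a::zero) set" where
  "points n = {x. \<forall>i\<ge>n. x i = 0}"

definition zero_set :: "nat \<Rightarrow> 'k::field mpoly set \<Rightarrow> (nat \<Rightarrow> 'k alg_closure) set" where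
  "zero_set n I = {x \<in> points n. \<forall>f\<in>I. eval_ac f x = 0}"

definition toric_set :: "nat \<Rightarrow> nat \<Rightarrow> (nat \<Rightarrow> (nat \<Rightarrow>\<^sub>0 nat)) \<Rightarrow> (nat \<Rightarrow> 'k::field alg_closure) set" where
  "toric_set n l colN = {(\<lambda>i. if i < n then (\<Prod>j<l. T j ^ Poly_Mapping.lookup (colN i) j) else 0) | T. T \<in> points l}"

end

theory Submission
  imports Defs
begin

text \<open>The forward implication is formal. For the converse, no Nullstellensatz is needed: it suffices that
every prime \<open>P\<close> containing \<open>I_N\<close> is contracted from \<open>K[t]\<close>, i.e. \<open>\<phi>(q) \<in> \<phi>(P)K[t]\<close> implies
\<open>q \<in> P\<close>. Indeed, if \<open>p \<in> I_M\<close> is not in \<open>rad(I_N + J)\<close>, choose a prime \<open>P \<supseteq> I_N + J\<close> with \<open>p \<notin> P\<close>; some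
\<open>\<phi>(p^k)\<close> lies in \<open>\<phi>(J)K[t]\<close>, whence \<open>p^k \<in> P\<close>.

The variables outside \<open>P\<close> form a face \<open>F\<close>, and the 0/1 indicator of \<open>F\<close> is a point of
\<open>V(I_N) = \<Gamma>(N)\<close>. Hence there is a set \<open>S\<close> of parameters such that \<open>x_i \<notin> P\<close> iff \<open>t^b_i\<close> involves only
parameters from \<open>S\<close>. Given \<open>\<phi>(q) = \<Sum> c_j \<phi>(q_j)\<close> with \<open>q_j \<in> P\<close>, discard from \<open>c_j\<close> all monomials
whose exponent is not in the lattice generated by the \<open>b_i\<close> with \<open>i \<in> F\<close>, and clear denominators with a
monomial \<open>x^\<gamma>\<close> supported on \<open>F\<close>. This shows \<open>x^\<gamma> q \<in> P\<close>, and \<open>x^\<gamma> \<notin> P\<close>.\<close>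

subsection \<open>Ideals of a subring given as a set\<close>

definition is_subring :: "'a::comm_ring_1 set \<Rightarrow> bool" where
  "is_subring R \<longleftrightarrow> 0 \<in> R \<and> 1 \<in> R \<and> (\<forall>a\<in>R. \<forall>b\<in>R. a + b \<in> R \<and> a * b \<in> R) \<and> (\<forall>a\<in>R. - a \<in> R)"

definition is_ideal_of :: "'a::comm_ring_1 set \<Rightarrow> 'a set \<Rightarrow> bool" where
  "is_ideal_of R I \<longleftrightarrow> I \<subseteq> R \<and> 0 \<in> I \<and> (\<forall>a\<in>I. \<forall>b\<in>I. a + b \<in> I) \<and> (\<forall>r\<in>R. \<forall>a\<in>I. r * a \<in> I)"

definition is_prime_of :: "'a::comm_ring_1 set \<Rightarrow> 'a set \<Rightarrow> bool" where
  "is_prime_of R P \<longleftrightarrow> is_ideal_of R P \<and> 1 \<notin> P \<and> (\<forall>a\<in>R. \<forall>b\<in>R. a * b \<in> P \<longrightarrow> a \<in> P \<or> b \<in> P)"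

lemma is_subringD:
  assumes "is_subring R"
  shows "0 \<in> R" "1 \<in> R" "a \<in> R \<Longrightarrow> b \<in> R \<Longrightarrow> a + b \<in> R"
    "a \<in> R \<Longrightarrow> b \<in> R \<Longrightarrow> a * b \<in> R" "a \<in> R \<Longrightarrow> - a \<in> R"
  using assms by (auto simp: is_subring_def)

lemma is_subring_power: "is_subring R \<Longrightarrow> a \<in> R \<Longrightarrow> a ^ k \<in> R"
  by (induction k) (auto simp: is_subringD)

lemma is_subring_of_nat: "is_subring R \<Longrightarrow> of_nat k \<in> R"
  by (induction k) (auto simp: is_subringD)

lemma is_ideal_ofD:
  assumes "is_ideal_of R I"
  shows "a \<in> I \<Longrightarrow> a \<in> R" "0 \<in> I" "a \<in> I \<Longrightarrow> b \<in> I \<Longrightarrow> a + b \<in> I"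
    "r \<in> R \<Longrightarrow> a \<in> I \<Longrightarrow> r * a \<in> I"
  using assms by (auto simp: is_ideal_of_def)

lemma is_ideal_of_sum: "is_ideal_of R I \<Longrightarrow> (\<And>x. x \<in> A \<Longrightarrow> f x \<in> I) \<Longrightarrow> sum f A \<in> I"
  by (induction A rule: infinite_finite_induct) (auto simp: is_ideal_ofD)

lemma is_ideal_of_diff:
  assumes "is_subring R" "is_ideal_of R I" "a \<in> I" "b \<in> I"
  shows "a - b \<in> I"
proof -
  have "a + (- 1) * b \<in> I"
    using assms by (intro is_ideal_ofD(3,4)[OF assms(2)] is_subringD) auto
  then show ?thesis by simp
qed

lemma is_prime_of_power:
  assumes "is_prime_of R P" "is_subring R" "a \<in> R" "a ^ k \<in> P"
  shows "a \<in> P"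
  using assms(4)
proof (induction k)
  case (Suc k)
  then show ?case
    using assms is_subring_power[OF assms(2,3), of k] by (auto simp: is_prime_of_def)
qed (use assms in \<open>auto simp: is_prime_of_def\<close>)

lemma gen_idealE:
  assumes "p \<in> gen_ideal R S"
  obtains F g where "finite F" "F \<subseteq> S" "\<forall>s\<in>F. g s \<in> R" "p = (\<Sum>s\<in>F. g s * s)"
  using assms by (auto simp: gen_ideal_def)

lemma is_ideal_of_gen_ideal:
  assumes "is_subring R" "S \<subseteq> R"
  shows "is_ideal_of R (gen_ideal R S)"
  unfolding is_ideal_of_def
proof (intro conjI ballI subsetI)
  fix x assume "x \<in> gen_ideal R S"
  then obtain F g where F: "F \<subseteq> S" "\<forall>s\<in>F. g s \<in> R" "x = (\<Sum>s\<in>F. g s * s)"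
    by (auto simp: gen_ideal_def)
  have "is_ideal_of R R" using assms by (auto simp: is_ideal_of_def is_subringD)
  then show "x \<in> R"
    unfolding F(3) using F assms by (intro is_ideal_of_sum) (auto intro!: is_subringD(4)[OF assms(1)])
next
  show "0 \<in> gen_ideal R S"
    unfolding gen_ideal_def by (intro CollectI exI[of _ "{}"]) auto
next
  fix x y assume x: "x \<in> gen_ideal R S" and y: "y \<in> gen_ideal R S"
  obtain F g where F: "finite F" "F \<subseteq> S" "\<forall>s\<in>F. g s \<in> R" "x = (\<Sum>s\<in>F. g s * s)"
    using x by (auto simp: gen_ideal_def)
  obtain G h where G: "finite G" "G \<subseteq> S" "\<forall>s\<in>G. h s \<in> R" "y = (\<Sum>s\<in>G. h s * s)"
    using y by (auto simp: gen_ideal_def)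
  define g' where "g' s = (if s \<in> F then g s else 0)" for s
  define h' where "h' s = (if s \<in> G then h s else 0)" for s
  have "x = (\<Sum>s\<in>F \<union> G. g' s * s)"
    unfolding F(4) using F(1) G(1) by (intro sum.mono_neutral_cong_left) (auto simp: g'_def)
  moreover have "y = (\<Sum>s\<in>F \<union> G. h' s * s)"
    unfolding G(4) using F(1) G(1) by (intro sum.mono_neutral_cong_left) (auto simp: h'_def)
  ultimately have "x + y = (\<Sum>s\<in>F \<union> G. (g' s + h' s) * s)"
    by (simp add: algebra_simps sum.distrib)
  moreover have "\<forall>s\<in>F \<union> G. g' s + h' s \<in> R"
    using F G assms by (auto simp: g'_def h'_def is_subringD)
  ultimately show "x + y \<in> gen_ideal R S"
    unfolding gen_ideal_def using F(1,2) G(1,2)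
    by (intro CollectI exI[of _ "F \<union> G"] exI[of _ "\<lambda>s. g' s + h' s"]) auto
next
  fix r x assume r: "r \<in> R" and "x \<in> gen_ideal R S"
  then obtain F g where F: "finite F" "F \<subseteq> S" "\<forall>s\<in>F. g s \<in> R" "x = (\<Sum>s\<in>F. g s * s)"
    by (auto simp: gen_ideal_def)
  have "r * x = (\<Sum>s\<in>F. (r * g s) * s)"
    by (simp add: F(4) sum_distrib_left mult_ac)
  with F r assms show "r * x \<in> gen_ideal R S"
    unfolding gen_ideal_def
    by (intro CollectI exI[of _ F] exI[of _ "\<lambda>s. r * g s"]) (auto simp: is_subringD)
qed

lemma gen_ideal_superset: "is_subring R \<Longrightarrow> S \<subseteq> gen_ideal R S"
proof
  fix s assume "is_subring R" "s \<in> S"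
  moreover have "s = (\<Sum>x\<in>{s}. 1 * x)" by simp
  ultimately show "s \<in> gen_ideal R S"
    unfolding gen_ideal_def
    by (intro CollectI exI[of _ "{s}"] exI[of _ "\<lambda>_. 1"]) (auto simp: is_subringD)
qed

lemma gen_ideal_least:
  assumes "is_ideal_of R I" "S \<subseteq> I"
  shows "gen_ideal R S \<subseteq> I"
  using assms by (auto simp: gen_ideal_def intro!: is_ideal_of_sum is_ideal_ofD(4))

lemma gen_ideal_mono: "S \<subseteq> T \<Longrightarrow> gen_ideal R S \<subseteq> gen_ideal R T"
  unfolding gen_ideal_def by blast

lemma is_ideal_of_ideal_sum:
  assumes "is_subring R" "is_ideal_of R I" "is_ideal_of R J"
  shows "is_ideal_of R (ideal_sum I J)"
  unfolding is_ideal_of_def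
proof (intro conjI ballI subsetI)
  show "0 \<in> ideal_sum I J"
    using assms by (force simp: ideal_sum_def intro: is_ideal_ofD(2))
next
  fix x assume "x \<in> ideal_sum I J"
  then show "x \<in> R" using assms by (auto simp: ideal_sum_def is_subringD is_ideal_ofD)
next
  fix x y assume "x \<in> ideal_sum I J" "y \<in> ideal_sum I J"
  then obtain a b c d where "x = a + b" "y = c + d" "a \<in> I" "b \<in> J" "c \<in> I" "d \<in> J"
    by (auto simp: ideal_sum_def)
  moreover from this have "x + y = (a + c) + (b + d)" by (simp add: ac_simps)
  ultimately show "x + y \<in> ideal_sum I J"
    using assms unfolding ideal_sum_def by (blast intro: is_ideal_ofD(3))
next
  fix r x assume "r \<in> R" "x \<in> ideal_sum I J"
  then obtain a b where "x = a + b" "a \<in> I" "b \<in> J"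
    by (auto simp: ideal_sum_def)
  moreover from this have "r * x = r * a + r * b" by (simp add: algebra_simps)
  ultimately show "r * x \<in> ideal_sum I J"
    using assms \<open>r \<in> R\<close> unfolding ideal_sum_def by (blast intro: is_ideal_ofD(4))
qed

lemma ideal_sum_superset:
  assumes "is_ideal_of R I" "is_ideal_of R J"
  shows "I \<subseteq> ideal_sum I J" "J \<subseteq> ideal_sum I J"
  using is_ideal_ofD(2)[OF assms(1)] is_ideal_ofD(2)[OF assms(2)]
  unfolding ideal_sum_def by (fastforce intro: exI[of _ 0])+

lemma ideal_sum_least:
  "is_ideal_of R K \<Longrightarrow> I \<subseteq> K \<Longrightarrow> J \<subseteq> K \<Longrightarrow> ideal_sum I J \<subseteq> K"
  by (auto simp: ideal_sum_def is_ideal_ofD subset_iff)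

lemma radical_superset: "I \<subseteq> R \<Longrightarrow> I \<subseteq> radical R I"
  unfolding radical_def by (auto intro: exI[of _ 1])

lemma radical_mono: "I \<subseteq> J \<Longrightarrow> radical R I \<subseteq> radical R J"
  by (auto simp: radical_def)

lemma radical_idem: "radical R (radical R I) = radical R I"
proof
  show "radical R (radical R I) \<subseteq> radical R I"
    by (auto simp: radical_def simp flip: power_mult)
next
  show "radical R I \<subseteq> radical R (radical R I)"
    by (intro radical_superset) (auto simp: radical_def)
qed

lemma is_ideal_of_radical:
  assumes "is_subring R" "is_ideal_of R I"
  shows "is_ideal_of R (radical R I)"
  unfolding is_ideal_of_def
proof (intro conjI ballI subsetI)
  show "0 \<in> radical R I"
    using assms by (auto simp: radical_def is_subringD is_ideal_ofD intro: exI[of _ 1])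
next
  fix x y assume "x \<in> radical R I" "y \<in> radical R I"
  then obtain i j where xy: "x \<in> R" "y \<in> R" "x ^ i \<in> I" "y ^ j \<in> I"
    by (auto simp: radical_def)
  have "(x + y) ^ (i + j) \<in> I"
    unfolding binomial_ring
  proof (intro is_ideal_of_sum[OF assms(2)])
    fix k assume k: "k \<in> {..i + j}"
    let ?c = "of_nat ((i + j) choose k) :: 'a"
    show "?c * x ^ k * y ^ (i + j - k) \<in> I"
    proof (cases "i \<le> k")
      case True
      then have "x ^ k = x ^ (k - i) * x ^ i" by (simp flip: power_add)
      then have "?c * x ^ k * y ^ (i + j - k) = (?c * x ^ (k - i) * y ^ (i + j - k)) * x ^ i"
        by (simp only: mult_ac)
      then show ?thesis
        by (simp only:) (intro is_ideal_ofD(4)[OF assms(2)] is_subringD(4)[OF assms(1)]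
            is_subring_power[OF assms(1)] is_subring_of_nat[OF assms(1)] xy)
    next
      case False
      then have "i + j - k = j + (i - k)" by simp
      then have "?c * x ^ k * y ^ (i + j - k) = (?c * x ^ k * y ^ (i - k)) * y ^ j"
        by (simp add: power_add mult_ac)
      then show ?thesis
        by (simp only:) (intro is_ideal_ofD(4)[OF assms(2)] is_subringD(4)[OF assms(1)]
            is_subring_power[OF assms(1)] is_subring_of_nat[OF assms(1)] xy)
    qed
  qed
  with xy assms show "x + y \<in> radical R I"
    by (auto simp: radical_def is_subringD)
next
  fix r x assume "r \<in> R" "x \<in> radical R I"
  then obtain i where x: "x \<in> R" "x ^ i \<in> I"
    by (auto simp: radical_def)
  then have "(r * x) ^ i \<in> I"
    unfolding power_mult_distrib
    by (intro is_ideal_ofD(4)[OF assms(2)] is_subring_power[OF assms(1)] \<open>r \<in> R\<close>)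
  with x \<open>r \<in> R\<close> assms(1) show "r * x \<in> radical R I"
    by (auto simp: radical_def is_subringD)
qed (auto simp: radical_def)

lemma exists_prime_avoiding_powers:
  assumes R: "is_subring R" and I: "is_ideal_of R I" and p: "p \<in> R" "p \<notin> radical R I"
  obtains P where "is_prime_of R P" "I \<subseteq> P" "p \<notin> P"
proof -
  define \<A> where "\<A> = {Q. is_ideal_of R Q \<and> I \<subseteq> Q \<and> (\<forall>k. p ^ k \<notin> Q)}"
  have "I \<in> \<A>" using assms by (auto simp: \<A>_def radical_def)
  have "\<exists>P\<in>\<A>. \<forall>M\<in>\<A>. P \<subseteq> M \<longrightarrow> M = P"
  proof (rule subset_Zorn_nonempty)
    show "\<A> \<noteq> {}" using \<open>I \<in> \<A>\<close> by blast
    fix C assume C: "C \<noteq> {}" "subset.chain \<A> C"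
    have CA: "C \<subseteq> \<A>" using C by (auto simp: subset.chain_def)
    have idC: "is_ideal_of R Q" if "Q \<in> C" for Q
      using CA that by (auto simp: \<A>_def)
    have tot: "M \<subseteq> N \<or> N \<subseteq> M" if "M \<in> C" "N \<in> C" for M N
      using C that by (auto simp: subset.chain_def)
    have "is_ideal_of R (\<Union>C)"
      unfolding is_ideal_of_def
    proof (intro conjI ballI)
      show "\<Union>C \<subseteq> R" "0 \<in> \<Union>C"
        using C CA by (auto simp: \<A>_def is_ideal_of_def)
    next
      fix a b assume "a \<in> \<Union>C" "b \<in> \<Union>C"
      then obtain M N where XY: "M \<in> C" "N \<in> C" "a \<in> M" "b \<in> N" by blast
      then obtain Z where "Z \<in> C" "a \<in> Z" "b \<in> Z" using tot[of M N] by blast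
      then show "a + b \<in> \<Union>C" using idC by (blast intro: is_ideal_ofD(3))
    next
      fix r a assume "r \<in> R" "a \<in> \<Union>C"
      then show "r * a \<in> \<Union>C" using idC by (blast intro: is_ideal_ofD(4))
    qed
    then show "\<Union>C \<in> \<A>" using C CA by (auto simp: \<A>_def)
  qed
  then obtain P where P: "P \<in> \<A>" "\<And>M. M \<in> \<A> \<Longrightarrow> P \<subseteq> M \<Longrightarrow> M = P" by blast
  have idP: "is_ideal_of R P" using P by (auto simp: \<A>_def)
  have pw: "p ^ k \<notin> P" for k using P by (auto simp: \<A>_def)
  have ext: "\<exists>k. \<exists>x\<in>P. \<exists>r\<in>R. p ^ k = x + r * a" if a: "a \<in> R" "a \<notin> P" for a
  proof -
    define Q where "Q = ideal_sum P (gen_ideal R {a})"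
    have ga: "is_ideal_of R (gen_ideal R {a})" using R a by (intro is_ideal_of_gen_ideal) auto
    have Q: "is_ideal_of R Q" "P \<subseteq> Q" "a \<in> Q"
      using is_ideal_of_ideal_sum[OF R idP ga] ideal_sum_superset[OF idP ga]
        gen_ideal_superset[OF R, of "{a}"] by (auto simp: Q_def)
    then have "Q \<notin> \<A>" using P(2)[of Q] a by blast
    with Q P(1) obtain k where "p ^ k \<in> Q" by (auto simp: \<A>_def)
    then obtain x y where xy: "p ^ k = x + y" "x \<in> P" "y \<in> gen_ideal R {a}"
      by (auto simp: Q_def ideal_sum_def)
    obtain F g where F: "F \<subseteq> {a}" "\<forall>s\<in>F. g s \<in> R" "y = (\<Sum>s\<in>F. g s * s)"
      using xy(3) by (auto simp: gen_ideal_def)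
    have "\<exists>r\<in>R. y = r * a"
    proof (cases "F = {}")
      case True
      with F R show ?thesis by (auto simp: is_subringD intro: bexI[of _ 0])
    next
      case False
      with F have "F = {a}" by blast
      with F show ?thesis by auto
    qed
    with xy show ?thesis by auto
  qed
  have "is_prime_of R P"
    unfolding is_prime_of_def
  proof (intro conjI ballI impI idP)
    show "1 \<notin> P" using pw[of 0] by simp
    fix a b assume ab: "a \<in> R" "b \<in> R" "a * b \<in> P"
    show "a \<in> P \<or> b \<in> P"
    proof (rule ccontr)
      assume "\<not> (a \<in> P \<or> b \<in> P)"
      then obtain i j x y r s where *: "x \<in> P" "y \<in> P" "r \<in> R" "s \<in> R"
          "p ^ i = x + r * a" "p ^ j = y + s * b"
        using ext[of a] ext[of b] ab by metis
      have "p ^ (i + j) = (p ^ j) * x + (r * a) * y + (r * s) * (a * b)"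
        unfolding power_add *(5,6) by (simp add: algebra_simps)
      also have "\<dots> \<in> P"
        using * ab R p
        by (intro is_ideal_ofD(3)[OF idP] is_ideal_ofD(4)[OF idP _ *(1)] is_ideal_ofD(4)[OF idP _ *(2)]
            is_ideal_ofD(4)[OF idP _ ab(3)] is_subringD(4)[OF R] is_subring_power[OF R])
      finally show False using P(1) by (auto simp: \<A>_def)
    qed
  qed
  moreover have "p \<notin> P" using pw[of 1] by simp
  ultimately show ?thesis using that P(1) by (auto simp: \<A>_def)
qed

subsection \<open>Toric maps\<close>

lemma poly_mapping_sum_singles:
  "f = (\<Sum>\<alpha>\<in>Poly_Mapping.keys f. Poly_Mapping.single \<alpha> (Poly_Mapping.lookup f \<alpha>))"
proof (rule poly_mapping_eqI)
  fix k
  show "Poly_Mapping.lookup f k = Poly_Mapping.lookup (\<Sum>\<alpha>\<in>Poly_Mapping.keys f. Poly_Mapping.single \<alpha> (Poly_Mapping.lookup f \<alpha>)) k"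
    by (simp add: lookup_sum lookup_single when_def in_keys_iff)
qed

lemma lookup_col_exp:
  "Poly_Mapping.lookup (col_exp col \<alpha>) j
    = (\<Sum>i\<in>Poly_Mapping.keys \<alpha>. of_nat (Poly_Mapping.lookup \<alpha> i) * Poly_Mapping.lookup (col i) j)"
  by (auto simp: col_exp_def lookup_sum Poly_Mapping.map.rep_eq when_def intro!: sum.cong)

lemma lookup_col_exp_superset:
  assumes "finite A" "Poly_Mapping.keys \<alpha> \<subseteq> A"
  shows "Poly_Mapping.lookup (col_exp col \<alpha>) j
    = (\<Sum>i\<in>A. of_nat (Poly_Mapping.lookup \<alpha> i) * Poly_Mapping.lookup (col i) j)"
  unfolding lookup_col_exp using assms
  by (intro sum.mono_neutral_left) (auto simp: in_keys_iff)

lemma col_exp_0 [simp]: "col_exp col 0 = 0"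
  by (simp add: col_exp_def)

lemma col_exp_add: "col_exp col (\<alpha> + \<beta>) = col_exp col \<alpha> + col_exp col \<beta>"
proof (rule poly_mapping_eqI)
  fix j
  let ?A = "Poly_Mapping.keys \<alpha> \<union> Poly_Mapping.keys \<beta>"
  show "Poly_Mapping.lookup (col_exp col (\<alpha> + \<beta>)) j = Poly_Mapping.lookup (col_exp col \<alpha> + col_exp col \<beta>) j"
    using keys_add[of \<alpha> \<beta>]
    by (simp add: lookup_add lookup_col_exp_superset[of ?A] algebra_simps sum.distrib)
qed

lemma keys_col_exp:
  assumes "\<And>i. i \<in> Poly_Mapping.keys \<alpha> \<Longrightarrow> Poly_Mapping.keys (col i) \<subseteq> S"
  shows "Poly_Mapping.keys (col_exp col \<alpha>) \<subseteq> S"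
proof
  fix j assume "j \<in> Poly_Mapping.keys (col_exp col \<alpha>)"
  then have "(\<Sum>i\<in>Poly_Mapping.keys \<alpha>. of_nat (Poly_Mapping.lookup \<alpha> i) * Poly_Mapping.lookup (col i) j) \<noteq> 0"
    by (simp add: in_keys_iff lookup_col_exp)
  then obtain i where i: "i \<in> Poly_Mapping.keys \<alpha>"
      "of_nat (Poly_Mapping.lookup \<alpha> i) * Poly_Mapping.lookup (col i) j \<noteq> 0"
    by (rule sum.not_neutral_contains_not_neutral)
  then have "Poly_Mapping.lookup (col i) j \<noteq> 0" by (metis mult_zero_right)
  then show "j \<in> S" using assms[OF i(1)] by (auto simp: in_keys_iff)
qed

lemma keys_col_subset_keys_col_exp:
  fixes col :: "nat \<Rightarrow> (nat \<Rightarrow>\<^sub>0 nat)"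
  assumes "i \<in> Poly_Mapping.keys \<alpha>"
  shows "Poly_Mapping.keys (col i) \<subseteq> Poly_Mapping.keys (col_exp col \<alpha>)"
  using assms by (auto simp: in_keys_iff lookup_col_exp intro!: bexI[of _ i])

lemma lookup_map_int: "Poly_Mapping.lookup (Poly_Mapping.map int a) k = int (Poly_Mapping.lookup a k)"
  by (simp add: Poly_Mapping.map.rep_eq when_def)

lemma col_exp_map_int: "col_exp (\<lambda>i. Poly_Mapping.map int (col i)) \<alpha> = Poly_Mapping.map int (col_exp col \<alpha>)"
  by (rule poly_mapping_eqI) (simp add: lookup_col_exp lookup_map_int)

lemma inj_map_int: "inj (Poly_Mapping.map int)"
proof (rule injI, rule poly_mapping_eqI)
  fix a b :: "'a \<Rightarrow>\<^sub>0 nat" and k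
  assume "Poly_Mapping.map int a = Poly_Mapping.map int b"
  then have "Poly_Mapping.lookup (Poly_Mapping.map int a) k = Poly_Mapping.lookup (Poly_Mapping.map int b) k"
    by simp
  then show "Poly_Mapping.lookup a k = Poly_Mapping.lookup b k"
    by (simp add: lookup_map_int)
qed

lemma toric_map_superset:
  assumes "finite A" "Poly_Mapping.keys f \<subseteq> A"
  shows "toric_map col f = (\<Sum>\<alpha>\<in>A. Poly_Mapping.single (col_exp col \<alpha>) (Poly_Mapping.lookup f \<alpha>))"
  unfolding toric_map_def using assms
  by (intro sum.mono_neutral_left) (auto simp: in_keys_iff)

lemma toric_map_0 [simp]: "toric_map col 0 = 0"
  by (simp add: toric_map_def)

lemma toric_map_single [simp]:
  "toric_map col (Poly_Mapping.single \<alpha> c) = Poly_Mapping.single (col_exp col \<alpha>) c"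
  by (subst toric_map_superset[of "{\<alpha>}"]) auto

lemma toric_map_1 [simp]: "toric_map col 1 = 1"
  using toric_map_single[of col 0 1] by simp

lemma toric_map_add: "toric_map col (f + g) = toric_map col f + toric_map col g"
  using keys_add[of f g]
  by (simp add: toric_map_superset[of "Poly_Mapping.keys f \<union> Poly_Mapping.keys g"] lookup_add single_add sum.distrib)

lemma toric_map_sum: "toric_map col (sum f A) = (\<Sum>x\<in>A. toric_map col (f x))"
  by (induction A rule: infinite_finite_induct) (simp_all add: toric_map_add)

lemma toric_map_diff: "toric_map col (f - g) = toric_map col f - toric_map col g"
  using toric_map_add[of col "f - g" g] by (simp add: algebra_simps)

lemma toric_map_mult: "toric_map col (f * g) = toric_map col f * toric_map col g"
proof -
  have "f * g = (\<Sum>\<alpha>\<in>Poly_Mapping.keys f. \<Sum>\<beta>\<in>Poly_Mapping.keys g.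
      Poly_Mapping.single (\<alpha> + \<beta>) (Poly_Mapping.lookup f \<alpha> * Poly_Mapping.lookup g \<beta>))"
    by (subst (1) poly_mapping_sum_singles[of f], subst (1) poly_mapping_sum_singles[of g])
      (simp add: sum_product mult_single)
  then show ?thesis
    by (simp add: toric_map_sum toric_map_def[of _ f] toric_map_def[of _ g]
        sum_product mult_single col_exp_add)
qed

lemma toric_map_power: "toric_map col (f ^ k) = toric_map col f ^ k"
  by (induction k) (simp_all add: toric_map_mult)

lemma lookup_toric_map:
  "Poly_Mapping.lookup (toric_map col f) \<beta>
    = (\<Sum>\<alpha>\<in>{\<alpha> \<in> Poly_Mapping.keys f. col_exp col \<alpha> = \<beta>}. Poly_Mapping.lookup f \<alpha>)"
  unfolding toric_map_def lookup_sum lookup_single when_def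
  by (simp add: sum.If_cases Int_def)

lemma toric_map_map_int_eq_0_iff:
  "toric_map (\<lambda>i. Poly_Mapping.map int (col i)) f = 0 \<longleftrightarrow> toric_map col f = 0"
proof
  assume *: "toric_map (\<lambda>i. Poly_Mapping.map int (col i)) f = 0"
  show "toric_map col f = 0"
  proof (rule poly_mapping_eqI)
    fix \<beta>
    have "Poly_Mapping.lookup (toric_map col f) \<beta>
        = Poly_Mapping.lookup (toric_map (\<lambda>i. Poly_Mapping.map int (col i)) f) (Poly_Mapping.map int \<beta>)"
      by (simp add: lookup_toric_map col_exp_map_int inj_eq[OF inj_map_int])
    then show "Poly_Mapping.lookup (toric_map col f) \<beta> = Poly_Mapping.lookup 0 \<beta>"
      by (simp add: *)
  qed
next
  assume *: "toric_map col f = 0"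
  show "toric_map (\<lambda>i. Poly_Mapping.map int (col i)) f = 0"
  proof (rule poly_mapping_eqI)
    fix \<gamma>
    show "Poly_Mapping.lookup (toric_map (\<lambda>i. Poly_Mapping.map int (col i)) f) \<gamma> = Poly_Mapping.lookup 0 \<gamma>"
    proof (cases "\<gamma> \<in> range (Poly_Mapping.map int)")
      case True
      then obtain \<beta> where "\<gamma> = Poly_Mapping.map int \<beta>" by blast
      then have "Poly_Mapping.lookup (toric_map (\<lambda>i. Poly_Mapping.map int (col i)) f) \<gamma>
          = Poly_Mapping.lookup (toric_map col f) \<beta>"
        by (simp add: lookup_toric_map col_exp_map_int inj_eq[OF inj_map_int])
      then show ?thesis by (simp add: *)
    next
      case False
      then have e: "{\<alpha> \<in> Poly_Mapping.keys f. Poly_Mapping.map int (col_exp col \<alpha>) = \<gamma>} = {}" by auto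
      show ?thesis by (simp only: lookup_toric_map col_exp_map_int e) simp
    qed
  qed
qed

lemma polys_in_iff: "f \<in> polys_in n \<longleftrightarrow> (\<forall>\<alpha>\<in>Poly_Mapping.keys f. Poly_Mapping.keys \<alpha> \<subseteq> {..<n})"
  by (auto simp: polys_in_def)

lemma single_in_polys_in: "Poly_Mapping.keys \<alpha> \<subseteq> {..<n} \<Longrightarrow> Poly_Mapping.single \<alpha> c \<in> polys_in n"
  by (auto simp: polys_in_iff)

lemma is_subring_polys_in: "is_subring (polys_in n :: 'k::comm_ring_1 mpoly set)"
  unfolding is_subring_def
proof (intro conjI ballI)
  fix a b :: "'k mpoly" assume ab: "a \<in> polys_in n" "b \<in> polys_in n"
  then show "a + b \<in> polys_in n" using keys_add[of a b] by (fastforce simp: polys_in_iff)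
  have "Poly_Mapping.keys (\<alpha> + \<beta>) \<subseteq> {..<n}"
    if "\<alpha> \<in> Poly_Mapping.keys a" "\<beta> \<in> Poly_Mapping.keys b" for \<alpha> \<beta>
    using that ab keys_add[of \<alpha> \<beta>] by (fastforce simp: polys_in_iff)
  then show "a * b \<in> polys_in n" using keys_mult[of a b] by (fastforce simp: polys_in_iff)
next
  fix a :: "'k mpoly" assume "a \<in> polys_in n"
  then show "- a \<in> polys_in n" by (auto simp: polys_in_iff in_keys_iff)
qed (auto simp: polys_in_iff)

lemma toric_map_in_polys_in:
  assumes "f \<in> polys_in n" "\<And>i. i < n \<Longrightarrow> Poly_Mapping.keys (col i) \<subseteq> {..<l}"
  shows "toric_map col f \<in> polys_in l"
  unfolding polys_in_iff
proof
  fix \<beta> assume "\<beta> \<in> Poly_Mapping.keys (toric_map col f)"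
  then have "{\<alpha> \<in> Poly_Mapping.keys f. col_exp col \<alpha> = \<beta>} \<noteq> {}"
    by (auto simp only: in_keys_iff lookup_toric_map sum.empty)
  then obtain \<alpha> where \<alpha>: "\<alpha> \<in> Poly_Mapping.keys f" "\<beta> = col_exp col \<alpha>"
    by blast
  with assms show "Poly_Mapping.keys \<beta> \<subseteq> {..<l}"
    unfolding \<alpha>(2) by (intro keys_col_exp) (auto simp: polys_in_iff subset_iff)
qed

lemma is_ideal_of_toric_ideal: "is_ideal_of (polys_in n) (toric_ideal n col)"
  using is_subringD[OF is_subring_polys_in]
  by (auto simp: is_ideal_of_def toric_ideal_def toric_map_add toric_map_mult)

lemma radical_toric_ideal:
  fixes col :: "nat \<Rightarrow> (nat \<Rightarrow>\<^sub>0 int)"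
  shows "radical (polys_in n) (toric_ideal n col :: 'k::field mpoly set) = toric_ideal n col"
proof
  show "radical (polys_in n) (toric_ideal n col :: 'k mpoly set) \<subseteq> toric_ideal n col"
    by (auto simp: radical_def toric_ideal_def toric_map_power)
  show "toric_ideal n col \<subseteq> radical (polys_in n) (toric_ideal n col :: 'k mpoly set)"
    by (intro radical_superset) (auto simp: toric_ideal_def)
qed

definition restrict_keys :: "'a set \<Rightarrow> ('a \<Rightarrow>\<^sub>0 'b::zero) \<Rightarrow> ('a \<Rightarrow>\<^sub>0 'b)" where
  "restrict_keys H f = Poly_Mapping.mapp (\<lambda>k v. v when k \<in> H) f"

lemma lookup_restrict_keys: "Poly_Mapping.lookup (restrict_keys H f) k = (Poly_Mapping.lookup f k when k \<in> H)"
  by (auto simp: restrict_keys_def lookup_mapp when_def in_keys_iff)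

lemma restrict_keys_0 [simp]: "restrict_keys H 0 = 0"
  by (rule poly_mapping_eqI) (simp add: lookup_restrict_keys)

lemma restrict_keys_add: "restrict_keys H (f + g) = restrict_keys H f + restrict_keys H (g :: _ \<Rightarrow>\<^sub>0 'b::monoid_add)"
  by (rule poly_mapping_eqI) (simp add: lookup_restrict_keys lookup_add when_add_distrib)

lemma restrict_keys_sum:
  "restrict_keys H (sum f A) = (\<Sum>x\<in>A. restrict_keys H (f x :: _ \<Rightarrow>\<^sub>0 'b::comm_monoid_add))"
  by (induction A rule: infinite_finite_induct) (simp_all add: restrict_keys_add)

lemma restrict_keys_single:
  "restrict_keys H (Poly_Mapping.single k v) = Poly_Mapping.single k (v when k \<in> H)"
  by (rule poly_mapping_eqI) (auto simp: lookup_restrict_keys lookup_single when_def)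

lemma keys_restrict_keys: "Poly_Mapping.keys (restrict_keys H f) = Poly_Mapping.keys f \<inter> H"
  by (auto simp: in_keys_iff lookup_restrict_keys)

lemma restrict_keys_mult_toric_map:
  fixes q :: "'k::comm_ring_1 mpoly"
  assumes "\<And>\<alpha>. \<alpha> \<in> Poly_Mapping.keys q \<Longrightarrow> \<beta> + col_exp col \<alpha> \<in> H \<longleftrightarrow> \<alpha> \<in> G \<and> \<beta> \<in> H"
  shows "restrict_keys H (Poly_Mapping.single \<beta> a * toric_map col q)
    = (if \<beta> \<in> H then Poly_Mapping.single \<beta> a * toric_map col (restrict_keys G q) else 0)"
proof -
  have "restrict_keys H (Poly_Mapping.single \<beta> a * toric_map col q)
    = (\<Sum>\<alpha>\<in>Poly_Mapping.keys q. Poly_Mapping.single (\<beta> + col_exp col \<alpha>)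
        (a * Poly_Mapping.lookup q \<alpha> when \<alpha> \<in> G \<and> \<beta> \<in> H))"
    using assms
    by (simp add: toric_map_def sum_distrib_left mult_single restrict_keys_sum restrict_keys_single)
  moreover have "toric_map col (restrict_keys G q) = (\<Sum>\<alpha>\<in>Poly_Mapping.keys q.
      Poly_Mapping.single (col_exp col \<alpha>) (Poly_Mapping.lookup q \<alpha> when \<alpha> \<in> G))"
    by (simp add: toric_map_superset[of "Poly_Mapping.keys q"] keys_restrict_keys lookup_restrict_keys)
  ultimately show ?thesis
    by (simp add: sum_distrib_left mult_single mult_when)
qed

subsection \<open>Primes containing a toric ideal\<close>

lemma monomial_in_prime_iff:
  fixes P :: "'k::field mpoly set"
  assumes P: "is_prime_of (polys_in n) P" and \<alpha>: "Poly_Mapping.keys \<alpha> \<subseteq> {..<n}"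
  shows "Poly_Mapping.single \<alpha> 1 \<in> P
    \<longleftrightarrow> (\<exists>i\<in>Poly_Mapping.keys \<alpha>. Poly_Mapping.single (Poly_Mapping.single i 1) 1 \<in> P)"
proof -
  define mon where "mon \<beta> = (Poly_Mapping.single \<beta> 1 :: 'k mpoly)" for \<beta>
  have id: "is_ideal_of (polys_in n) P" using P by (simp add: is_prime_of_def)
  have mon_add: "mon (\<beta> + \<gamma>) = mon \<beta> * mon \<gamma>" for \<beta> \<gamma>
    by (simp add: mon_def mult_single)
  have mon_0: "mon 0 \<notin> P" using P by (simp add: is_prime_of_def mon_def)
  have mon_in: "mon \<beta> \<in> polys_in n" if "Poly_Mapping.keys \<beta> \<subseteq> {..<n}" for \<beta>
    using that by (simp add: mon_def single_in_polys_in)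
  have mult_iff: "mon (\<beta> + \<gamma>) \<in> P \<longleftrightarrow> mon \<beta> \<in> P \<or> mon \<gamma> \<in> P"
    if "Poly_Mapping.keys \<beta> \<subseteq> {..<n}" "Poly_Mapping.keys \<gamma> \<subseteq> {..<n}" for \<beta> \<gamma>
  proof
    assume "mon (\<beta> + \<gamma>) \<in> P"
    then show "mon \<beta> \<in> P \<or> mon \<gamma> \<in> P"
      using P mon_in[OF that(1)] mon_in[OF that(2)] unfolding mon_add is_prime_of_def by blast
  next
    assume "mon \<beta> \<in> P \<or> mon \<gamma> \<in> P"
    then show "mon (\<beta> + \<gamma>) \<in> P"
      using is_ideal_ofD(4)[OF id mon_in[OF that(1)], of "mon \<gamma>"]
        is_ideal_ofD(4)[OF id mon_in[OF that(2)], of "mon \<beta>"]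
      unfolding mon_add by (auto simp: mult.commute)
  qed
  have pow: "mon (Poly_Mapping.single i v) \<in> P \<longleftrightarrow> v \<noteq> 0 \<and> mon (Poly_Mapping.single i 1) \<in> P" if "i < n" for i v
  proof (induction v)
    case (Suc v)
    have "Poly_Mapping.single i (Suc v) = Poly_Mapping.single i 1 + Poly_Mapping.single i v"
      by (simp flip: single_add)
    then show ?case
      using mult_iff[of "Poly_Mapping.single i 1" "Poly_Mapping.single i v"] Suc that by auto
  qed (use mon_0 in simp)
  have "mon (\<Sum>i\<in>A. Poly_Mapping.single i (h i)) \<in> P \<longleftrightarrow> (\<exists>i\<in>A. h i \<noteq> 0 \<and> mon (Poly_Mapping.single i 1) \<in> P)"
    if "finite A" "A \<subseteq> {..<n}" for A and h :: "nat \<Rightarrow> nat"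
    using that
  proof (induction A)
    case (insert i A)
    have "Poly_Mapping.keys (\<Sum>i\<in>A. Poly_Mapping.single i (h i)) \<subseteq> A"
      by (rule order.trans[OF keys_sum]) auto
    then have "Poly_Mapping.keys (\<Sum>i\<in>A. Poly_Mapping.single i (h i)) \<subseteq> {..<n}"
      using insert.prems by auto
    moreover have "Poly_Mapping.keys (Poly_Mapping.single i (h i)) \<subseteq> {..<n}"
      using insert.prems by auto
    ultimately show ?case
      using insert pow[of i "h i"] by (simp add: mult_iff)
  qed (use mon_0 in simp)
  from this[of "Poly_Mapping.keys \<alpha>" "Poly_Mapping.lookup \<alpha>"] show ?thesis
    using \<alpha> by (simp add: mon_def in_keys_iff flip: poly_mapping_sum_singles)
qed

lemma diff_restrict_keys_in_prime:
  fixes P :: "'k::field mpoly set"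
  assumes P: "is_prime_of (polys_in n) P" and q: "q \<in> polys_in n"
  shows "q - restrict_keys {\<alpha>. \<forall>i\<in>Poly_Mapping.keys \<alpha>. Poly_Mapping.single (Poly_Mapping.single i 1) 1 \<notin> P} q \<in> P"
proof -
  define G :: "(nat \<Rightarrow>\<^sub>0 nat) set" where "G = {\<alpha>. \<forall>i\<in>Poly_Mapping.keys \<alpha>. Poly_Mapping.single (Poly_Mapping.single i 1) 1 \<notin> P}"
  have id: "is_ideal_of (polys_in n) P" using P by (simp add: is_prime_of_def)
  have "q - restrict_keys G q = (\<Sum>\<alpha>\<in>Poly_Mapping.keys (q - restrict_keys G q).
      Poly_Mapping.single \<alpha> (Poly_Mapping.lookup (q - restrict_keys G q) \<alpha>))"
    by (rule poly_mapping_sum_singles)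
  also have "\<dots> \<in> P"
  proof (rule is_ideal_of_sum[OF id])
    fix \<alpha> assume "\<alpha> \<in> Poly_Mapping.keys (q - restrict_keys G q)"
    then have "\<alpha> \<notin> G" "\<alpha> \<in> Poly_Mapping.keys q"
      by (auto simp: in_keys_iff lookup_minus lookup_restrict_keys when_def split: if_splits)
    then have "Poly_Mapping.single \<alpha> 1 \<in> P"
      using monomial_in_prime_iff[OF P, of \<alpha>] q by (auto simp: polys_in_iff G_def)
    moreover have "(Poly_Mapping.single 0 c :: 'k mpoly) \<in> polys_in n" for c
      by (rule single_in_polys_in) simp
    ultimately have "Poly_Mapping.single 0 c * Poly_Mapping.single \<alpha> 1 \<in> P" for c
      by (intro is_ideal_ofD(4)[OF id])
    then show "Poly_Mapping.single \<alpha> (Poly_Mapping.lookup (q - restrict_keys G q) \<alpha>) \<in> P"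
      by (simp add: mult_single)
  qed
  finally show ?thesis by (simp add: G_def)
qed

lemma contraction_of_extended_prime:
  fixes P :: "'k::field mpoly set" and col :: "nat \<Rightarrow> (nat \<Rightarrow>\<^sub>0 nat)"
  assumes P: "is_prime_of (polys_in n) P"
    and ker: "\<And>f. f \<in> polys_in n \<Longrightarrow> toric_map col f = 0 \<Longrightarrow> f \<in> P"
    and S: "\<And>i. i < n \<Longrightarrow> Poly_Mapping.single (Poly_Mapping.single i 1) 1 \<notin> P \<longleftrightarrow> Poly_Mapping.keys (col i) \<subseteq> S"
    and q: "q \<in> polys_in n" "toric_map col q \<in> gen_ideal R (toric_map col ` P)"
  shows "q \<in> P"
proof -
  let ?mon = "\<lambda>\<gamma>. Poly_Mapping.single \<gamma> 1 :: 'k mpoly"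
  let ?\<phi> = "toric_map col :: 'k mpoly \<Rightarrow> 'k mpoly"
  let ?N = "col_exp col"
  define U :: "(nat \<Rightarrow>\<^sub>0 nat) set" where "U = {\<alpha>. \<forall>i\<in>Poly_Mapping.keys \<alpha>. ?mon (Poly_Mapping.single i 1) \<notin> P}"
  define G where "G = {\<alpha> \<in> U. Poly_Mapping.keys \<alpha> \<subseteq> {..<n}}"
  \<comment> \<open>\<open>H\<close> consists of the exponents lying in the group generated by the columns of the face.
    Restriction to \<open>H\<close> is linear over the subalgebra spanned by the monomials of the face,
    and it kills every multiple of a monomial \<open>\<phi>(x^\<alpha>)\<close> with \<open>x^\<alpha> \<in> P\<close>.\<close>
  define H where "H = {\<beta>. \<exists>\<gamma>\<in>G. \<exists>\<delta>\<in>G. \<beta> + ?N \<gamma> = ?N \<delta>}"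
  have id: "is_ideal_of (polys_in n) P" using P by (simp add: is_prime_of_def)
  note ring = is_subringD[OF is_subring_polys_in[where 'k = 'k, of n]]
  have G_0: "0 \<in> G" by (simp add: G_def U_def)
  have G_add: "\<gamma> + \<delta> \<in> G" if "\<gamma> \<in> G" "\<delta> \<in> G" for \<gamma> \<delta>
    using that keys_add[of \<gamma> \<delta>] by (fastforce simp: G_def U_def)
  have H_iff: "\<beta> + ?N \<alpha> \<in> H \<longleftrightarrow> \<alpha> \<in> U \<and> \<beta> \<in> H" if \<alpha>: "Poly_Mapping.keys \<alpha> \<subseteq> {..<n}" for \<alpha> \<beta>
  proof
    assume "\<alpha> \<in> U \<and> \<beta> \<in> H"
    then obtain \<gamma> \<delta> where *: "\<alpha> \<in> G" "\<gamma> \<in> G" "\<delta> \<in> G" "\<beta> + ?N \<gamma> = ?N \<delta>"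
      using \<alpha> by (auto simp: G_def H_def)
    then have "\<beta> + ?N \<alpha> + ?N \<gamma> = ?N (\<delta> + \<alpha>)"
      by (simp add: col_exp_add add.assoc add.commute add.left_commute flip: *(4))
    with * G_add show "\<beta> + ?N \<alpha> \<in> H" by (auto simp: H_def)
  next
    assume "\<beta> + ?N \<alpha> \<in> H"
    then obtain \<gamma> \<delta> where *: "\<gamma> \<in> G" "\<delta> \<in> G" "\<beta> + ?N \<alpha> + ?N \<gamma> = ?N \<delta>"
      by (auto simp: H_def)
    have "Poly_Mapping.keys (?N \<delta>) \<subseteq> S"
      using *(2) S by (intro keys_col_exp) (auto simp: G_def U_def subset_iff)
    moreover have "Poly_Mapping.keys (?N \<alpha>) \<subseteq> Poly_Mapping.keys (?N \<delta>)"
      by (auto simp: in_keys_iff lookup_add simp flip: *(3))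
    ultimately have "Poly_Mapping.keys (col i) \<subseteq> S" if "i \<in> Poly_Mapping.keys \<alpha>" for i
      using keys_col_subset_keys_col_exp[OF that, of col] by blast
    then have "\<alpha> \<in> U" using S \<alpha> by (fastforce simp: U_def)
    then have "\<alpha> + \<gamma> \<in> G" using *(1) \<alpha> by (intro G_add) (auto simp: G_def)
    moreover have "\<beta> + ?N (\<alpha> + \<gamma>) = ?N \<delta>" using *(3) by (simp add: col_exp_add add.assoc)
    ultimately show "\<alpha> \<in> U \<and> \<beta> \<in> H" using *(2) \<open>\<alpha> \<in> U\<close> by (auto simp: H_def)
  qed
  have restrict_single: "restrict_keys H (Poly_Mapping.single \<beta> a * ?\<phi> r)
      = (if \<beta> \<in> H then Poly_Mapping.single \<beta> a * ?\<phi> (restrict_keys U r) else 0)"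
    if "r \<in> polys_in n" for r \<beta> a
    using that by (intro restrict_keys_mult_toric_map H_iff) (auto simp: polys_in_iff)
  have restrict_in: "restrict_keys U r \<in> polys_in n" if "r \<in> polys_in n" for r :: "'k mpoly"
    using that by (auto simp: polys_in_iff keys_restrict_keys)
  have diff_in: "r - restrict_keys U r \<in> P" if "r \<in> polys_in n" for r
    using diff_restrict_keys_in_prime[OF P that] by (simp add: U_def)
  have mon_in: "Poly_Mapping.single \<gamma> c \<in> polys_in n" if "\<gamma> \<in> G" for \<gamma> and c :: 'k
    using that by (intro single_in_polys_in) (auto simp: G_def)
  \<comment> \<open>Multiplying by a monomial of the face clears denominators and brings the restriction back into \<open>\<phi>(P)\<close>.\<close>
  define L where "L = {c. \<exists>\<gamma>\<in>G. \<exists>d\<in>P. ?\<phi> (?mon \<gamma>) * restrict_keys H c = ?\<phi> d}"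
  have L_0: "0 \<in> L"
    using G_0 is_ideal_ofD(2)[OF id] by (auto simp: L_def intro!: bexI[of _ 0])
  have L_add: "c + c' \<in> L" if cc: "c \<in> L" "c' \<in> L" for c c'
  proof -
    obtain \<gamma> d where *: "\<gamma> \<in> G" "d \<in> P" "?\<phi> (?mon \<gamma>) * restrict_keys H c = ?\<phi> d"
      using cc(1) by (auto simp: L_def)
    obtain \<gamma>' d' where **: "\<gamma>' \<in> G" "d' \<in> P" "?\<phi> (?mon \<gamma>') * restrict_keys H c' = ?\<phi> d'"
      using cc(2) by (auto simp: L_def)
    have "?mon (\<gamma> + \<gamma>') = ?mon \<gamma> * ?mon \<gamma>'" by (simp add: mult_single)
    then have "?\<phi> (?mon (\<gamma> + \<gamma>')) * restrict_keys H (c + c')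
        = ?\<phi> (?mon \<gamma>') * (?\<phi> (?mon \<gamma>) * restrict_keys H c)
          + ?\<phi> (?mon \<gamma>) * (?\<phi> (?mon \<gamma>') * restrict_keys H c')"
      by (simp only: toric_map_mult restrict_keys_add) (simp only: algebra_simps)
    also have "\<dots> = ?\<phi> (?mon \<gamma>' * d + ?mon \<gamma> * d')"
      by (simp only: *(3) **(3) toric_map_add toric_map_mult)
    finally have "?\<phi> (?mon (\<gamma> + \<gamma>')) * restrict_keys H (c + c') = ?\<phi> (?mon \<gamma>' * d + ?mon \<gamma> * d')" .
    moreover have "?mon \<gamma>' * d + ?mon \<gamma> * d' \<in> P"
      by (intro is_ideal_ofD(3)[OF id] is_ideal_ofD(4)[OF id] mon_in * **)
    ultimately show ?thesis
      unfolding L_def using G_add[OF *(1) **(1)] by blast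
  qed
  have L_sum: "sum g A \<in> L" if "\<And>x. x \<in> A \<Longrightarrow> g x \<in> L" for g :: "'k mpoly \<Rightarrow> 'k mpoly" and A
    using that by (induction A rule: infinite_finite_induct) (simp_all add: L_0 L_add)
  have L_sum': "sum g A \<in> L" if "\<And>x. x \<in> A \<Longrightarrow> g x \<in> L" for g :: "(nat \<Rightarrow>\<^sub>0 nat) \<Rightarrow> 'k mpoly" and A
    using that by (induction A rule: infinite_finite_induct) (simp_all add: L_0 L_add)
  have L_single: "Poly_Mapping.single \<beta> a * ?\<phi> r \<in> L" if r: "r \<in> P" for r \<beta> a
  proof (cases "\<beta> \<in> H")
    case True
    have rn: "r \<in> polys_in n" using is_ideal_ofD(1)[OF id r] .
    obtain \<gamma> \<delta> where *: "\<gamma> \<in> G" "\<delta> \<in> G" "\<beta> + ?N \<gamma> = ?N \<delta>"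
      using True by (auto simp: H_def)
    have "?\<phi> (?mon \<gamma>) * Poly_Mapping.single \<beta> a = ?\<phi> (Poly_Mapping.single \<delta> a)"
      using *(3) by (simp add: mult_single add.commute)
    then have "?\<phi> (?mon \<gamma>) * restrict_keys H (Poly_Mapping.single \<beta> a * ?\<phi> r)
        = ?\<phi> (Poly_Mapping.single \<delta> a * restrict_keys U r)"
      using True by (simp only: restrict_single[OF rn] if_True toric_map_mult flip: mult.assoc)
    moreover have "r - (r - restrict_keys U r) \<in> P"
      by (intro is_ideal_of_diff[OF is_subring_polys_in id] r diff_in rn)
    then have "Poly_Mapping.single \<delta> a * restrict_keys U r \<in> P"
      using *(2) by (intro is_ideal_ofD(4)[OF id] mon_in) simp_all
    ultimately show ?thesis using *(1) unfolding L_def by blast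
  next
    case False
    then have "restrict_keys H (Poly_Mapping.single \<beta> a * ?\<phi> r) = 0"
      using restrict_single is_ideal_ofD(1)[OF id r] by simp
    then show ?thesis
      using G_0 is_ideal_ofD(2)[OF id] by (auto simp: L_def intro!: bexI[of _ 0])
  qed
  have L_mult: "c * ?\<phi> r \<in> L" if "r \<in> P" for c r
    by (subst poly_mapping_sum_singles[of c], subst sum_distrib_right)
      (intro L_sum' L_single that)
  have "gen_ideal R (?\<phi> ` P) \<subseteq> L"
    unfolding gen_ideal_def by (auto intro!: L_sum) (use L_mult in blast)
  with q obtain \<gamma> d where *: "\<gamma> \<in> G" "d \<in> P" "?\<phi> (?mon \<gamma>) * restrict_keys H (?\<phi> q) = ?\<phi> d"
    by (auto simp: L_def)
  have "0 \<in> H" using G_0 by (auto simp: H_def)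
  then have "restrict_keys H (?\<phi> q) = ?\<phi> (restrict_keys U q)"
    using restrict_single[OF q(1), of 0 1] by simp
  with *(3) have "?\<phi> (?mon \<gamma> * restrict_keys U q - d) = 0"
    by (simp add: toric_map_diff toric_map_mult)
  moreover have "?mon \<gamma> * restrict_keys U q - d \<in> polys_in n"
    using ring(3)[OF ring(4)[OF mon_in[OF *(1)] restrict_in[OF q(1)]] ring(5)[OF is_ideal_ofD(1)[OF id *(2)]]]
    by simp
  ultimately have "?mon \<gamma> * restrict_keys U q - d \<in> P" by (intro ker)
  from is_ideal_ofD(3)[OF id this *(2)] have "?mon \<gamma> * restrict_keys U q \<in> P" by simp
  moreover have "?mon \<gamma> \<notin> P"
    using monomial_in_prime_iff[OF P, of \<gamma>] *(1) by (auto simp: G_def U_def)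
  ultimately have "restrict_keys U q \<in> P"
    using P mon_in[OF *(1)] restrict_in[OF q(1)] unfolding is_prime_of_def by blast
  from is_ideal_ofD(3)[OF id diff_in[OF q(1)] this] show ?thesis by simp
qed

lemma exists_support_of_face:
  fixes P :: "'k::field mpoly set" and col :: "nat \<Rightarrow> (nat \<Rightarrow>\<^sub>0 nat)"
  assumes P: "is_prime_of (polys_in n) P"
    and ker: "\<And>f. f \<in> polys_in n \<Longrightarrow> toric_map col f = 0 \<Longrightarrow> f \<in> P"
    and dim: "\<And>i. i < n \<Longrightarrow> Poly_Mapping.keys (col i) \<subseteq> {..<l}"
    and gamma: "zero_set n {f \<in> polys_in n :: 'k mpoly set. toric_map col f = 0} \<subseteq> toric_set n l col"
  obtains S where
    "\<And>i. i < n \<Longrightarrow> Poly_Mapping.single (Poly_Mapping.single i 1) 1 \<notin> P \<longleftrightarrow> Poly_Mapping.keys (col i) \<subseteq> S"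
proof -
  define F where "F = {i. i < n \<and> Poly_Mapping.single (Poly_Mapping.single i 1) 1 \<notin> P}"
  \<comment> \<open>This 0/1 point lies on \<open>V(I_N)\<close>; the support of a preimage \<open>T\<close> of it in \<open>\<Gamma>(N)\<close> is the required \<open>S\<close>.\<close>
  define e :: "nat \<Rightarrow> 'k alg_closure" where "e i = (if i \<in> F then 1 else 0)" for i
  have id: "is_ideal_of (polys_in n) P" using P by (simp add: is_prime_of_def)
  have face: "Poly_Mapping.keys \<alpha> \<subseteq> F \<longleftrightarrow> Poly_Mapping.keys \<beta> \<subseteq> F"
    if \<alpha>: "Poly_Mapping.keys \<alpha> \<subseteq> {..<n}" and \<beta>: "Poly_Mapping.keys \<beta> \<subseteq> {..<n}"
      and eq: "col_exp col \<alpha> = col_exp col \<beta>" for \<alpha> \<beta>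
  proof -
    let ?a = "Poly_Mapping.single \<alpha> 1 :: 'k mpoly" and ?b = "Poly_Mapping.single \<beta> 1 :: 'k mpoly"
    have in_n: "?a \<in> polys_in n" "?b \<in> polys_in n"
      using \<alpha> \<beta> by (auto intro: single_in_polys_in)
    have "?a - ?b \<in> P"
    proof (rule ker)
      show "?a - ?b \<in> polys_in n"
        using is_subringD(3,5)[OF is_subring_polys_in] in_n by (metis diff_conv_add_uminus)
      show "toric_map col (?a - ?b) = 0" by (simp add: toric_map_diff eq)
    qed
    then have "?a \<in> P \<longleftrightarrow> ?b \<in> P"
      using is_ideal_ofD(3)[OF id, of "?a - ?b" ?b]
        is_ideal_of_diff[OF is_subring_polys_in id, of ?a "?a - ?b"] by auto
    then show ?thesis
      using monomial_in_prime_iff[OF P \<alpha>] monomial_in_prime_iff[OF P \<beta>] \<alpha> \<beta>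
      by (auto simp: F_def subset_iff)
  qed
  have "eval_ac f e = 0" if f: "f \<in> polys_in n" "toric_map col f = 0" for f
  proof -
    define A where "A = {\<alpha> \<in> Poly_Mapping.keys f. Poly_Mapping.keys \<alpha> \<subseteq> F}"
    have [simp]: "finite A" by (simp add: A_def)
    have prod: "(\<Prod>i\<in>Poly_Mapping.keys \<alpha>. e i ^ Poly_Mapping.lookup \<alpha> i) = (if Poly_Mapping.keys \<alpha> \<subseteq> F then 1 else 0)" for \<alpha>
      by (auto simp: e_def in_keys_iff intro!: prod.neutral)
    have "eval_ac f e = (\<Sum>\<alpha>\<in>A. to_ac (Poly_Mapping.lookup f \<alpha>))"
      unfolding eval_ac_def prod by (rule sum.mono_neutral_cong_right) (auto simp: A_def)
    also have "\<dots> = to_ac (\<Sum>\<alpha>\<in>A. Poly_Mapping.lookup f \<alpha>)"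
      by (simp add: to_ac_sum)
    also have "(\<Sum>\<alpha>\<in>A. Poly_Mapping.lookup f \<alpha>)
        = (\<Sum>\<beta>\<in>col_exp col ` A. \<Sum>\<alpha>\<in>{\<alpha> \<in> A. col_exp col \<alpha> = \<beta>}. Poly_Mapping.lookup f \<alpha>)"
      by (rule sum.image_gen) simp
    also have "\<dots> = (\<Sum>\<beta>\<in>col_exp col ` A. Poly_Mapping.lookup (toric_map col f) \<beta>)"
    proof (rule sum.cong[OF refl])
      fix \<beta> assume "\<beta> \<in> col_exp col ` A"
      then have "{\<alpha> \<in> A. col_exp col \<alpha> = \<beta>} = {\<alpha> \<in> Poly_Mapping.keys f. col_exp col \<alpha> = \<beta>}"
        using face f(1) by (auto simp: A_def polys_in_iff)
      then show "(\<Sum>\<alpha>\<in>{\<alpha> \<in> A. col_exp col \<alpha> = \<beta>}. Poly_Mapping.lookup f \<alpha>) = Poly_Mapping.lookup (toric_map col f) \<beta>"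
        by (simp add: lookup_toric_map)
    qed
    finally show ?thesis by (simp add: f(2))
  qed
  then have "e \<in> zero_set n {f \<in> polys_in n :: 'k mpoly set. toric_map col f = 0}"
    by (auto simp: zero_set_def points_def e_def F_def)
  with gamma obtain T where T: "e = (\<lambda>i. if i < n then (\<Prod>j<l. T j ^ Poly_Mapping.lookup (col i) j) else 0)"
    by (auto simp: toric_set_def)
  show ?thesis
  proof (rule that)
    fix i assume "i < n"
    then have "Poly_Mapping.single (Poly_Mapping.single i 1) 1 \<notin> P \<longleftrightarrow> e i \<noteq> 0"
      by (simp add: e_def F_def)
    also have "\<dots> \<longleftrightarrow> (\<forall>j<l. Poly_Mapping.lookup (col i) j = 0 \<or> T j \<noteq> 0)"
      using \<open>i < n\<close> by (subst T) auto
    also have "\<dots> \<longleftrightarrow> Poly_Mapping.keys (col i) \<subseteq> {j. T j \<noteq> 0}"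
    proof -
      have "j < l" if "Poly_Mapping.lookup (col i) j \<noteq> 0" for j
        using dim[OF \<open>i < n\<close>] that by (auto simp: in_keys_iff subset_iff)
      then show ?thesis
        by (simp add: in_keys_iff subset_iff) (metis neq0_conv)
    qed
    finally show "Poly_Mapping.single (Poly_Mapping.single i 1) 1 \<notin> P \<longleftrightarrow> Poly_Mapping.keys (col i) \<subseteq> {j. T j \<noteq> 0}" .
  qed
qed

theorem theorem3p1:
  fixes m n l s :: nat
    and colM :: "nat \<Rightarrow> (nat \<Rightarrow>\<^sub>0 int)"
    and colN :: "nat \<Rightarrow> (nat \<Rightarrow>\<^sub>0 nat)"
    and f :: "nat \<Rightarrow> 'k::field mpoly"
  assumes colM_dim: "\<And>i. i < n \<Longrightarrow> Poly_Mapping.keys (colM i) \<subseteq> {..<m}"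
    and colM_nz: "\<And>i. i < n \<Longrightarrow> colM i \<noteq> 0"
    and colN_dim: "\<And>i. i < n \<Longrightarrow> Poly_Mapping.keys (colN i) \<subseteq> {..<l}"
    and colN_nz: "\<And>i. i < n \<Longrightarrow> colN i \<noteq> 0"
    and incl: "(toric_ideal n (\<lambda>i. Poly_Mapping.map int (colN i)) :: 'k mpoly set) \<subseteq> toric_ideal n colM"
    and gamma: "(toric_set n l colN :: (nat \<Rightarrow> 'k alg_closure) set)
                  = zero_set n (toric_ideal n (\<lambda>i. Poly_Mapping.map int (colN i)))"
    and fI: "\<And>i. i < s \<Longrightarrow> f i \<in> toric_ideal n colM"
  shows "toric_ideal n colM
           = radical (polys_in n) (ideal_sum (toric_ideal n (\<lambda>i. Poly_Mapping.map int (colN i))) (gen_ideal (polys_in n) (f ` {..<s})))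
    \<longleftrightarrow> radical (polys_in l) (gen_ideal (polys_in l) (toric_map colN ` toric_ideal n colM))
           = radical (polys_in l) (gen_ideal (polys_in l) ((\<lambda>i. toric_map colN (f i)) ` {..<s}))"
proof -
  let ?Rn = "polys_in n :: 'k mpoly set" and ?Rl = "polys_in l :: 'k mpoly set"
  let ?\<phi> = "toric_map colN :: 'k mpoly \<Rightarrow> 'k mpoly"
  let ?IM = "toric_ideal n colM :: 'k mpoly set"
  define IN where "IN = (toric_ideal n (\<lambda>i. Poly_Mapping.map int (colN i)) :: 'k mpoly set)"
  define J where "J = gen_ideal ?Rn (f ` {..<s})"
  define E where "E = gen_ideal ?Rl (?\<phi> ` ?IM)"
  define K where "K = gen_ideal ?Rl (?\<phi> ` f ` {..<s})"
  note Rn = is_subring_polys_in[where 'k = 'k, of n] and Rl = is_subring_polys_in[where 'k = 'k, of l]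
  have IN_eq: "IN = {f \<in> ?Rn. ?\<phi> f = 0}"
    by (simp add: IN_def toric_ideal_def toric_map_map_int_eq_0_iff)
  have idM: "is_ideal_of ?Rn ?IM" and idN: "is_ideal_of ?Rn IN"
    by (simp_all add: IN_def is_ideal_of_toric_ideal)
  have f_IM: "f ` {..<s} \<subseteq> ?IM" using fI by auto
  have IM_Rn: "?IM \<subseteq> ?Rn" by (auto simp: toric_ideal_def)
  have \<phi>_Rl: "?\<phi> p \<in> ?Rl" if "p \<in> ?Rn" for p
    using that colN_dim by (rule toric_map_in_polys_in)
  have idJ: "is_ideal_of ?Rn J" using f_IM IM_Rn Rn by (auto simp: J_def intro!: is_ideal_of_gen_ideal)
  have idNJ: "is_ideal_of ?Rn (ideal_sum IN J)" by (rule is_ideal_of_ideal_sum[OF Rn idN idJ])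
  have idK: "is_ideal_of ?Rl K"
    unfolding K_def using f_IM IM_Rn \<phi>_Rl by (intro is_ideal_of_gen_ideal Rl) blast
  have idE: "is_ideal_of ?Rl E"
    unfolding E_def using IM_Rn \<phi>_Rl by (intro is_ideal_of_gen_ideal Rl) blast
  have KE: "radical ?Rl K \<subseteq> radical ?Rl E"
    unfolding K_def E_def using f_IM by (intro radical_mono gen_ideal_mono) blast
  have NJ_M: "radical ?Rn (ideal_sum IN J) \<subseteq> ?IM"
  proof -
    have "ideal_sum IN J \<subseteq> ?IM"
      using incl gen_ideal_least[OF idM f_IM] by (intro ideal_sum_least[OF idM]) (auto simp: IN_def J_def)
    then show ?thesis using radical_mono radical_toric_ideal by blast
  qed
  have "?IM = radical ?Rn (ideal_sum IN J) \<longleftrightarrow> radical ?Rl E = radical ?Rl K"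
  proof
    assume eq: "?IM = radical ?Rn (ideal_sum IN J)"
    have "?\<phi> p \<in> K" if pJ: "p \<in> J" for p
    proof -
      obtain F g where F: "finite F" "F \<subseteq> f ` {..<s}" "\<forall>s\<in>F. g s \<in> ?Rn" "p = (\<Sum>s\<in>F. g s * s)"
        using pJ unfolding J_def by (rule gen_idealE)
      have "?\<phi> (g h) * ?\<phi> h \<in> K" if "h \<in> F" for h
      proof (rule is_ideal_ofD(4)[OF idK])
        show "?\<phi> (g h) \<in> ?Rl" using that F(3) by (intro \<phi>_Rl) blast
        show "?\<phi> h \<in> K"
          using that F(2) gen_ideal_superset[OF Rl, of "?\<phi> ` f ` {..<s}"] unfolding K_def by blast
      qed
      then show ?thesis
        unfolding F(4) toric_map_sum toric_map_mult by (rule is_ideal_of_sum[OF idK])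
    qed
    then have \<phi>_K: "?\<phi> p \<in> K" if "p \<in> ideal_sum IN J" for p
      using that by (auto simp: ideal_sum_def toric_map_add IN_eq)
    have "?\<phi> ` ?IM \<subseteq> radical ?Rl K"
    proof (rule image_subsetI)
      fix p assume "p \<in> ?IM"
      then obtain k where "p \<in> ?Rn" "p ^ k \<in> ideal_sum IN J"
        by (subst (asm) eq) (auto simp: radical_def)
      then show "?\<phi> p \<in> radical ?Rl K"
        using \<phi>_K[of "p ^ k"] \<phi>_Rl by (auto simp: radical_def toric_map_power)
    qed
    then have "E \<subseteq> radical ?Rl K"
      unfolding E_def by (intro gen_ideal_least is_ideal_of_radical Rl idK)
    then have "radical ?Rl E \<subseteq> radical ?Rl K"
      using radical_mono radical_idem by metis
    with KE show "radical ?Rl E = radical ?Rl K" by blast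
  next
    assume eq: "radical ?Rl E = radical ?Rl K"
    have "p \<in> radical ?Rn (ideal_sum IN J)" if p: "p \<in> ?IM" for p
    proof (rule ccontr)
      assume "p \<notin> radical ?Rn (ideal_sum IN J)"
      with p IM_Rn obtain P where P: "is_prime_of ?Rn P" "ideal_sum IN J \<subseteq> P" "p \<notin> P"
        using exists_prime_avoiding_powers[OF Rn idNJ] by blast
      have NP: "IN \<subseteq> P" and JP: "J \<subseteq> P"
        using P(2) ideal_sum_superset[OF idN idJ] by auto
      have ker: "\<And>f. f \<in> ?Rn \<Longrightarrow> ?\<phi> f = 0 \<Longrightarrow> f \<in> P"
        using NP by (auto simp: IN_eq)
      have "zero_set n {f \<in> ?Rn. ?\<phi> f = 0} \<subseteq> toric_set n l colN"
        using gamma IN_eq by (simp add: IN_def)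
      from exists_support_of_face[OF P(1) ker colN_dim this] obtain S where
        S: "\<And>i. i < n \<Longrightarrow> Poly_Mapping.single (Poly_Mapping.single i 1) 1 \<notin> P \<longleftrightarrow> Poly_Mapping.keys (colN i) \<subseteq> S"
        by blast
      have "?\<phi> p \<in> E"
        unfolding E_def by (rule subsetD[OF gen_ideal_superset[OF Rl] imageI[OF p]])
      moreover have "E \<subseteq> radical ?Rl E"
        by (intro radical_superset subsetI is_ideal_ofD(1)[OF idE])
      ultimately have "?\<phi> p \<in> radical ?Rl K"
        using eq by blast
      then obtain k where "?\<phi> p ^ k \<in> K"
        by (auto simp: radical_def)
      moreover have "f ` {..<s} \<subseteq> P"
        using JP gen_ideal_superset[OF Rn, of "f ` {..<s}"] unfolding J_def by (rule order.trans[rotated])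
      then have "K \<subseteq> gen_ideal ?Rl (?\<phi> ` P)"
        unfolding K_def by (intro gen_ideal_mono image_mono)
      ultimately have "?\<phi> (p ^ k) \<in> gen_ideal ?Rl (?\<phi> ` P)"
        unfolding toric_map_power by blast
      with p IM_Rn have "p ^ k \<in> P"
        by (intro contraction_of_extended_prime[OF P(1) ker S] is_subring_power[OF Rn]) blast+
      then show False
        using P p IM_Rn is_prime_of_power[OF P(1) Rn] by blast
    qed
    with NJ_M show "?IM = radical ?Rn (ideal_sum IN J)" by blast
  qed
  then show ?thesis
    by (simp add: IN_def J_def E_def K_def image_image)
qed

end
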